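(* Let $\mathcal H$ be a real Hilbert space, let $n\ge 1$ be an integer, $I=\{1,\dots,n\}$, and let $\lambda_i>0$ ($i\in I$) satisfy $\sum_{i\in I}\lambda_i=1$. Suppose that for each $i\in I$, $A_i:\mathcal H\to\mathcal H$ is a nonexpansive and monotone mapping. Write $\mathbf A=(A_1,\dots,A_n)$, $\boldsymbol\lambda=(\lambda_1,\dots,\lambda_n)$. Then $\mathcal R(\mathbf A,\boldsymbol\lambda)$ is nonexpansive. Furthermore, for each $i\in I$, $A_i=2J_{B_i}-\mathrm{Id}$ where $B_i$ is maximally monotone and nonexpansive, and $\mathcal R(\mathbf A,\boldsymbol\lambda)=2J_B-\mathrm{Id}$ where $B$ is the maximally monotone and nonexpansive mapping given by $B=\sum_{i\in I}\lambda_iB_i$.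
   Context: A mapping $T:\mathcal H\to\mathcal H$ is nonexpansive if $\|Tx-Ty\|\le\|x-y\|$ for all $x,y\in\mathcal H$. The resolvent of $A:\mathcal H\rightrightarrows\mathcal H$ is $J_A=(A+\mathrm{Id})^{-1}$, where inverses are set-valued inverses ($x\in A^{-1}u\Leftrightarrow u\in Ax$) and $\mathrm{Id}$ is the identity. The $\boldsymbol\lambda$-weighted resolvent average of $\mathbf A$ (with parameter $1$) is the set-valued mapping $$\mathcal R(\mathbf A,\boldsymbol\lambda)=\Big(\sum_{i\in I}\lambda_i(A_i+\mathrm{Id})^{-1}\Big)^{-1}-\mathrm{Id};$$ sums and multiples are pointwise Minkowski operations. A set-valued mapping all of whose values are singletons is identified with a function $\mathcal H\to\mathcal H$. *)

theory Defs
  imports "HOL-Analysis.Analysis" "HOL-Library.Set_Algebras"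
begin

text \<open>
  A set-valued mapping on \<open>'a\<close> is a function \<open>'a \<Rightarrow> 'a set\<close>. On sets, \<open>+\<close> and \<open>\<Sum>\<close> are the
  Minkowski operations of \<^theory>\<open>HOL-Library.Set_Algebras\<close>, whereas \<open>-\<close> is set
  difference; the Minkowski difference is therefore spelled out in \<open>sv_diff\<close>.
\<close>

type_synonym 'a svm = "'a \<Rightarrow> 'a set"

definition single :: "('a \<Rightarrow> 'a) \<Rightarrow> 'a svm" where
  "single T = (\<lambda>x. {T x})"

definition sv_Id :: "'a svm" where
  "sv_Id = single (\<lambda>x. x)"

definition sv_inverse :: "'a svm \<Rightarrow> 'a svm" where
  "sv_inverse A = (\<lambda>u. {x. u \<in> A x})"

definition sv_add :: "('a::real_vector) svm \<Rightarrow> 'a svm \<Rightarrow> 'a svm" where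
  "sv_add A B = (\<lambda>x. A x + B x)"

definition sv_diff :: "('a::real_vector) svm \<Rightarrow> 'a svm \<Rightarrow> 'a svm" where
  "sv_diff A B = (\<lambda>x. {u - v | u v. u \<in> A x \<and> v \<in> B x})"

definition sv_scale :: "real \<Rightarrow> ('a::real_vector) svm \<Rightarrow> 'a svm" where
  "sv_scale c A = (\<lambda>x. (\<lambda>u. c *\<^sub>R u) ` A x)"

definition sv_sum :: "('i \<Rightarrow> ('a::real_vector) svm) \<Rightarrow> 'i set \<Rightarrow> 'a svm" where
  "sv_sum A I = (\<lambda>x. \<Sum>i\<in>I. A i x)"

definition resolvent :: "('a::real_vector) svm \<Rightarrow> 'a svm" where
  "resolvent A = sv_inverse (sv_add A sv_Id)"

definition resolvent_average ::
  "'i set \<Rightarrow> ('i \<Rightarrow> ('a::real_vector) svm) \<Rightarrow> ('i \<Rightarrow> real) \<Rightarrow> 'a svm" where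
  "resolvent_average I A w =
     sv_diff (sv_inverse (sv_sum (\<lambda>i. sv_scale (w i) (sv_inverse (sv_add (A i) sv_Id))) I)) sv_Id"

definition nonexpansive :: "('a::real_normed_vector \<Rightarrow> 'a) \<Rightarrow> bool" where
  "nonexpansive T \<longleftrightarrow> (\<forall>x y. norm (T x - T y) \<le> norm (x - y))"

text \<open>
  A set-valued mapping counts as nonexpansive only if it is single-valued on the whole space and
  the function it is thereby identified with is nonexpansive.
\<close>

definition sv_nonexpansive :: "('a::real_normed_vector) svm \<Rightarrow> bool" where
  "sv_nonexpansive A \<longleftrightarrow> (\<exists>T. A = single T \<and> nonexpansive T)"

definition sv_monotone :: "('a::real_inner) svm \<Rightarrow> bool" where
  "sv_monotone A \<longleftrightarrow> (\<forall>x y. \<forall>u\<in>A x. \<forall>v\<in>A y. 0 \<le> (u - v) \<bullet> (x - y))"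

text \<open>Maximality is with respect to inclusion of graphs, i.e. pointwise inclusion of values.\<close>

definition maximally_monotone :: "('a::real_inner) svm \<Rightarrow> bool" where
  "maximally_monotone A \<longleftrightarrow>
     sv_monotone A \<and> (\<forall>B. sv_monotone B \<and> (\<forall>x. A x \<subseteq> B x) \<longrightarrow> B = A)"

end

theory Submission
  imports Defs
begin

text \<open>
  For a nonexpansive monotone \<open>T\<close> the map \<open>T + Id\<close> is a bijection (it is strongly monotone and
  Lipschitz, so Banach's fixed point theorem applies); write \<open>J\<^sub>T\<close> for its inverse. The graph of the
  reflected resolvent \<open>2 J\<^sub>T - Id\<close> consists of the pairs \<open>(T x + x, x - T x)\<close>. With \<open>a = x - y\<close> and
  \<open>b = T x - T y\<close> one has
    \<open>(a - b) \<bullet> (a + b) = \<parallel>a\<parallel>\<^sup>2 - \<parallel>b\<parallel>\<^sup>2\<close> and \<open>\<parallel>a + b\<parallel>\<^sup>2 - \<parallel>a - b\<parallel>\<^sup>2 = 4 (a \<bullet> b)\<close>,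
  so passing to the reflected resolvent exchanges the two hypotheses: nonexpansiveness of \<open>T\<close> gives
  monotonicity of \<open>2 J\<^sub>T - Id\<close>, and monotonicity of \<open>T\<close> gives its nonexpansiveness
  (\<open>reflected_resolvent_nonexp_mono\<close>).

  Up to dilation the reflected resolvent is an involution: \<open>A = 2 J\<^sub>B - Id\<close> for
  \<open>B x = J\<^sub>A (2 x) - x\<close> (\<open>reflected_resolvent_cayley\<close>). This yields the \<open>B\<^sub>i\<close>. The class of
  nonexpansive monotone maps is convex, so \<open>B = (\<Sum>i. w i B\<^sub>i)\<close> belongs to it and satisfies
  \<open>(\<Sum>i. w i J\<^bsub>A\<^sub>i\<^esub>) (2 x) = B x + x\<close>. Solving this for \<open>x\<close> identifies the resolvent average with
  \<open>2 J\<^sub>B - Id\<close>, which is therefore nonexpansive. Maximality comes from the surjectivity of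
  \<open>T + Id\<close>, the easy half of Minty's theorem.
\<close>

section \<open>Nonexpansive monotone maps and their resolvents\<close>

text \<open>The class of mappings in question, stated for functions rather than singleton-valued mappings.\<close>

definition nonexp_mono :: "('a::real_inner \<Rightarrow> 'a) \<Rightarrow> bool" where
  "nonexp_mono T \<longleftrightarrow> nonexpansive T \<and> (\<forall>x y. 0 \<le> (T x - T y) \<bullet> (x - y))"

text \<open>The resolvent as a function; meaningful when \<open>T + Id\<close> is bijective.\<close>

definition res :: "('a::real_inner \<Rightarrow> 'a) \<Rightarrow> 'a \<Rightarrow> 'a" where
  "res T = inv (\<lambda>x. T x + x)"

definition reflected_resolvent :: "('a::real_inner \<Rightarrow> 'a) \<Rightarrow> 'a \<Rightarrow> 'a" where
  "reflected_resolvent T = (\<lambda>y. 2 *\<^sub>R res T y - y)"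

text \<open>The map whose reflected resolvent is \<open>T\<close>.\<close>

definition cayley :: "('a::real_inner \<Rightarrow> 'a) \<Rightarrow> 'a \<Rightarrow> 'a" where
  "cayley T = (\<lambda>x. res T (2 *\<^sub>R x) - x)"

section \<open>Calculus of singleton-valued mappings\<close>

lemma single_eq_iff: "single S = single T \<longleftrightarrow> S = T"
  by (auto simp: single_def fun_eq_iff)

lemma sv_monotone_single: "sv_monotone (single T) \<longleftrightarrow> (\<forall>x y. 0 \<le> (T x - T y) \<bullet> (x - y))"
  by (simp add: sv_monotone_def single_def)

lemma sv_nonexpansive_single [simp]: "sv_nonexpansive (single T) \<longleftrightarrow> nonexpansive T"
  by (auto simp: sv_nonexpansive_def single_eq_iff)

lemma sv_add_single: "sv_add (single S) (single T) = single (\<lambda>x. S x + T x)"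
  by (simp add: sv_add_def single_def set_plus_def)

lemma sv_diff_single: "sv_diff (single S) (single T) = single (\<lambda>x. S x - T x)"
  by (simp add: sv_diff_def single_def)

lemma sv_scale_single: "sv_scale c (single T) = single (\<lambda>x. c *\<^sub>R T x)"
  by (simp add: sv_scale_def single_def)

lemma sv_sum_single:
  assumes "finite I"
  shows "sv_sum (\<lambda>i. single (T i)) I = single (\<lambda>x. \<Sum>i\<in>I. T i x)"
proof
  fix x
  show "sv_sum (\<lambda>i. single (T i)) I x = single (\<lambda>x. \<Sum>i\<in>I. T i x) x"
    using assms unfolding sv_sum_def single_def
    by (induction I rule: finite_induct) (simp_all add: set_plus_def set_zero)
qed

lemma sv_sum_cong: "(\<And>i. i \<in> I \<Longrightarrow> S i = T i) \<Longrightarrow> sv_sum S I = sv_sum T I"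
  by (simp add: sv_sum_def)

lemma sv_inverse_single: "bij T \<Longrightarrow> sv_inverse (single T) = single (inv T)"
  by (auto simp: sv_inverse_def single_def fun_eq_iff bij_inv_eq_iff bij_is_surj surj_f_inv_f)

section \<open>Bijectivity, reflected resolvents and maximality\<close>

lemma nonexp_mono_add_id_bij:
  fixes T :: "'a::{real_inner, complete_space} \<Rightarrow> 'a"
  assumes "nonexp_mono T"
  shows "bij (\<lambda>x. T x + x)"
proof -
  have "\<exists>!x. T x + x = u" for u
  proof -
    \<comment> \<open>Solutions are the fixed points of \<open>x \<mapsto> x - t (T x + x - u)\<close>. As \<open>T + Id\<close> is
      1-strongly monotone and 2-Lipschitz, the squared Lipschitz constant of this map is at most
      \<open>1 - 2 t + 4 t\<^sup>2\<close>, whose minimum 3/4 is attained at \<open>t = 1/4\<close>.\<close>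
    define G where "G = (\<lambda>x. x - (1/4) *\<^sub>R (T x + x - u))"
    have contr: "dist (G x) (G y) \<le> sqrt (3/4) * dist x y" for x y
    proof -
      define a b where "a = x - y" and "b = T x - T y"
      have mono: "0 \<le> b \<bullet> a" and "norm b \<le> norm a"
        using assms by (auto simp: nonexp_mono_def nonexpansive_def a_def b_def)
      then have nonexp: "b \<bullet> b \<le> a \<bullet> a"
        by (simp add: norm_le)
      have "G x - G y = a - (1/4) *\<^sub>R (b + a)"
        unfolding G_def a_def b_def by (simp add: algebra_simps)
      then have "(norm (G x - G y))\<^sup>2 = (9/16) * (a \<bullet> a) - (3/8) * (b \<bullet> a) + (1/16) * (b \<bullet> b)"
        by (simp only: power2_norm_eq_inner)
          (simp add: inner_diff_left inner_diff_right inner_add_left inner_add_right inner_commute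
            field_simps)
      also have "\<dots> \<le> (3/4) * (a \<bullet> a)"
        using mono nonexp inner_ge_zero[of a] by linarith
      also have "\<dots> = (sqrt (3/4) * norm a)\<^sup>2"
        by (simp add: power_mult_distrib power2_norm_eq_inner)
      finally show ?thesis
        unfolding dist_norm a_def by (rule power2_le_imp_le) simp
    qed
    have "\<exists>!x. G x = x"
      by (rule banach_fix_type[where c = "sqrt (3/4)"]) (use contr in auto)
    then show ?thesis
      by (simp add: G_def)
  qed
  then show ?thesis
    by (auto simp: bij_iff)
qed

context
  fixes T :: "'a::{real_inner, complete_space} \<Rightarrow> 'a"
  assumes T: "nonexp_mono T"
begin

lemma res_eq_iff: "res T u = x \<longleftrightarrow> T x + x = u"
  unfolding res_def using bij_inv_eq_iff[OF nonexp_mono_add_id_bij[OF T], of x u] by auto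

lemma sv_inverse_add_Id_single: "sv_inverse (sv_add (single T) sv_Id) = single (res T)"
  unfolding sv_Id_def sv_add_single res_def
  by (rule sv_inverse_single[OF nonexp_mono_add_id_bij[OF T]])

lemma sv_reflected_resolvent_single:
  "sv_diff (sv_scale 2 (resolvent (single T))) sv_Id = single (reflected_resolvent T)"
  unfolding resolvent_def sv_inverse_add_Id_single
  by (simp add: sv_scale_single sv_Id_def sv_diff_single reflected_resolvent_def)

lemma reflected_resolvent_nonexp_mono: "nonexp_mono (reflected_resolvent T)"
proof -
  let ?R = "reflected_resolvent T"
  have "norm (?R u - ?R v) \<le> norm (u - v) \<and> 0 \<le> (?R u - ?R v) \<bullet> (u - v)" for u v
  proof -
    define x y where "x = res T u" and "y = res T v"
    define a b where "a = x - y" and "b = T x - T y"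
    have u: "u = T x + x" and v: "v = T y + y"
      using res_eq_iff[of u x] res_eq_iff[of v y] by (simp_all add: x_def y_def)
    have "?R u = x - T x" "?R v = y - T y"
      unfolding reflected_resolvent_def x_def[symmetric] y_def[symmetric]
      by (simp_all add: u v scaleR_2)
    then have R: "?R u - ?R v = a - b" and uv: "u - v = a + b"
      by (simp_all add: a_def b_def u v)
    have mono: "0 \<le> b \<bullet> a" and "norm b \<le> norm a"
      using T by (auto simp: nonexp_mono_def nonexpansive_def a_def b_def)
    then have nonexp: "b \<bullet> b \<le> a \<bullet> a"
      by (simp add: norm_le)
    show ?thesis
      unfolding R uv norm_le using mono nonexp
      by (simp add: inner_diff_left inner_diff_right inner_add_left inner_add_right inner_commute)
  qed
  then show ?thesis
    by (simp add: nonexp_mono_def nonexpansive_def)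
qed

lemma cayley_nonexp_mono: "nonexp_mono (cayley T)"
proof -
  \<comment> \<open>\<open>cayley T\<close> is the reflected resolvent of \<open>T\<close> conjugated by the dilation by 2.\<close>
  have cayley: "cayley T x - cayley T y
      = (1/2) *\<^sub>R (reflected_resolvent T (2 *\<^sub>R x) - reflected_resolvent T (2 *\<^sub>R y))" for x y
    by (simp add: cayley_def reflected_resolvent_def algebra_simps)
  have dilate: "2 *\<^sub>R x - 2 *\<^sub>R y = 2 *\<^sub>R (x - y)" for x y :: 'a
    by (simp add: algebra_simps)
  have "norm (cayley T x - cayley T y) \<le> norm (x - y)
      \<and> 0 \<le> (cayley T x - cayley T y) \<bullet> (x - y)" for x y
  proof -
    have "norm (reflected_resolvent T (2 *\<^sub>R x) - reflected_resolvent T (2 *\<^sub>R y))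
        \<le> norm (2 *\<^sub>R x - 2 *\<^sub>R y)"
      and "0 \<le> (reflected_resolvent T (2 *\<^sub>R x) - reflected_resolvent T (2 *\<^sub>R y))
        \<bullet> (2 *\<^sub>R x - 2 *\<^sub>R y)"
      using reflected_resolvent_nonexp_mono unfolding nonexp_mono_def nonexpansive_def by blast+
    then show ?thesis
      unfolding cayley dilate by simp
  qed
  then show ?thesis
    by (simp add: nonexp_mono_def nonexpansive_def)
qed

text \<open>
  If \<open>u \<in> C x\<close> for a monotone extension \<open>C\<close>, choose \<open>z\<close> with \<open>T z + z = u + x\<close>; monotonicity
  between \<open>(x, u)\<close> and \<open>(z, T z)\<close> then reads \<open>0 \<le> - \<parallel>x - z\<parallel>\<^sup>2\<close>.
\<close>

lemma maximally_monotone_single: "maximally_monotone (single T)"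
  unfolding maximally_monotone_def
proof (intro conjI allI impI)
  show "sv_monotone (single T)"
    using T by (simp add: sv_monotone_single nonexp_mono_def)
next
  fix C :: "'a svm"
  assume "sv_monotone C \<and> (\<forall>x. single T x \<subseteq> C x)"
  then have mono: "sv_monotone C" and ext: "T x \<in> C x" for x
    by (auto simp: single_def)
  have "u = T x" if "u \<in> C x" for u x
  proof -
    define z where "z = res T (u + x)"
    have z: "T z + z = u + x"
      by (simp add: z_def flip: res_eq_iff)
    then have "u - T z = - (x - z)"
      by (simp add: algebra_simps)
    then have "(u - T z) \<bullet> (x - z) = - ((x - z) \<bullet> (x - z))"
      by (simp only: inner_minus_left)
    moreover have "0 \<le> (u - T z) \<bullet> (x - z)"
      using mono that ext unfolding sv_monotone_def by blast
    ultimately have "(x - z) \<bullet> (x - z) = 0"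
      using inner_ge_zero[of "x - z"] by linarith
    then have "x = z"
      by simp
    then show ?thesis
      using z by simp
  qed
  then show "C = single T"
    using ext by (auto simp: single_def fun_eq_iff)
qed

end

lemma reflected_resolvent_cayley:
  fixes T :: "'a::{real_inner, complete_space} \<Rightarrow> 'a"
  assumes T: "nonexp_mono T"
  shows "reflected_resolvent (cayley T) = T"
proof
  fix p
  have "res T (T p + p) = p"
    by (simp add: res_eq_iff[OF T])
  then have "res (cayley T) p = (1/2) *\<^sub>R (T p + p)"
    unfolding res_eq_iff[OF cayley_nonexp_mono[OF T]] by (simp add: cayley_def)
  then show "reflected_resolvent (cayley T) p = T p"
    by (simp add: reflected_resolvent_def)
qed

section \<open>Convex combinations and the resolvent average\<close>

lemma nonexp_mono_convex_sum:
  assumes "\<And>i. i \<in> I \<Longrightarrow> nonexp_mono (T i)"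
    and w: "\<And>i. i \<in> I \<Longrightarrow> 0 \<le> w i" "(\<Sum>i\<in>I. w i) = 1"
  shows "nonexp_mono (\<lambda>x. \<Sum>i\<in>I. w i *\<^sub>R T i x)"
proof -
  have diff: "(\<Sum>i\<in>I. w i *\<^sub>R T i x) - (\<Sum>i\<in>I. w i *\<^sub>R T i y)
      = (\<Sum>i\<in>I. w i *\<^sub>R (T i x - T i y))" for x y
    by (simp add: sum_subtractf scaleR_diff_right)
  have "norm (\<Sum>i\<in>I. w i *\<^sub>R (T i x - T i y)) \<le> norm (x - y)" for x y
  proof -
    have "norm (\<Sum>i\<in>I. w i *\<^sub>R (T i x - T i y)) \<le> (\<Sum>i\<in>I. w i * norm (x - y))"
      using assms
      by (intro sum_norm_le) (simp add: nonexp_mono_def nonexpansive_def mult_left_mono)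
    also have "\<dots> = norm (x - y)"
      using w by (simp flip: sum_distrib_right)
    finally show ?thesis .
  qed
  moreover have "0 \<le> (\<Sum>i\<in>I. w i *\<^sub>R (T i x - T i y)) \<bullet> (x - y)" for x y
    using assms by (auto simp: inner_sum_left nonexp_mono_def intro!: sum_nonneg mult_nonneg_nonneg)
  ultimately show ?thesis
    by (simp add: nonexp_mono_def nonexpansive_def diff)
qed

lemma resolvent_average_single:
  fixes A :: "'i \<Rightarrow> 'a::{real_inner, complete_space} \<Rightarrow> 'a"
  assumes "finite I" and A: "\<And>i. i \<in> I \<Longrightarrow> nonexp_mono (A i)"
    and w: "\<And>i. i \<in> I \<Longrightarrow> 0 \<le> w i" "(\<Sum>i\<in>I. w i) = 1"
  shows "resolvent_average I (\<lambda>i. single (A i)) w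
    = single (reflected_resolvent (\<lambda>x. \<Sum>i\<in>I. w i *\<^sub>R cayley (A i) x))"
proof -
  define B where "B = (\<lambda>x. \<Sum>i\<in>I. w i *\<^sub>R cayley (A i) x)"
  define J where "J = (\<lambda>x. \<Sum>i\<in>I. w i *\<^sub>R res (A i) x)"
  have B: "nonexp_mono B"
    unfolding B_def by (rule nonexp_mono_convex_sum) (use cayley_nonexp_mono A w in auto)
  have "sv_sum (\<lambda>i. sv_scale (w i) (sv_inverse (sv_add (single (A i)) sv_Id))) I
      = sv_sum (\<lambda>i. single (\<lambda>x. w i *\<^sub>R res (A i) x)) I"
    by (rule sv_sum_cong) (simp add: sv_inverse_add_Id_single A sv_scale_single)
  also have "\<dots> = single J"
    unfolding J_def by (rule sv_sum_single[OF \<open>finite I\<close>])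
  finally have avg: "resolvent_average I (\<lambda>i. single (A i)) w
      = sv_diff (sv_inverse (single J)) sv_Id"
    by (simp add: resolvent_average_def)
  have B_eq: "B x + x = J (2 *\<^sub>R x)" for x
    using w by (simp add: B_def J_def cayley_def scaleR_diff_right sum_subtractf
        flip: scaleR_sum_left)
  have "J u = y \<longleftrightarrow> u = 2 *\<^sub>R res B y" for u y
  proof -
    have "J u = y \<longleftrightarrow> res B y = (1/2) *\<^sub>R u"
      by (simp add: res_eq_iff[OF B] B_eq)
    also have "\<dots> \<longleftrightarrow> u = 2 *\<^sub>R res B y"
      by auto
    finally show ?thesis .
  qed
  then have "y = J u \<longleftrightarrow> u = 2 *\<^sub>R res B y" for u y
    by metis
  then have "sv_inverse (single J) = single (\<lambda>y. 2 *\<^sub>R res B y)"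
    by (simp add: sv_inverse_def single_def)
  then show ?thesis
    unfolding avg B_def[symmetric] by (simp add: sv_Id_def sv_diff_single reflected_resolvent_def)
qed

theorem theorem4p16:
  fixes A :: "nat \<Rightarrow> ('a::{real_inner, complete_space}) \<Rightarrow> 'a"
    and w :: "nat \<Rightarrow> real"
    and n :: nat
  assumes "n \<ge> 1"
    and "\<And>i. i \<in> {1..n} \<Longrightarrow> w i > 0"
    and "(\<Sum>i\<in>{1..n}. w i) = 1"
    and "\<And>i. i \<in> {1..n} \<Longrightarrow> nonexpansive (A i)"
    and "\<And>i. i \<in> {1..n} \<Longrightarrow> sv_monotone (single (A i))"
  shows "sv_nonexpansive (resolvent_average {1..n} (\<lambda>i. single (A i)) w)
    \<and> (\<exists>(Bi :: nat \<Rightarrow> 'a svm) (B :: 'a svm).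
          (\<forall>i\<in>{1..n}. maximally_monotone (Bi i) \<and> sv_nonexpansive (Bi i)
             \<and> single (A i) = sv_diff (sv_scale 2 (resolvent (Bi i))) sv_Id)
        \<and> B = sv_sum (\<lambda>i. sv_scale (w i) (Bi i)) {1..n}
        \<and> maximally_monotone B \<and> sv_nonexpansive B
        \<and> resolvent_average {1..n} (\<lambda>i. single (A i)) w
            = sv_diff (sv_scale 2 (resolvent B)) sv_Id)"
proof -
  have A: "nonexp_mono (A i)" if "i \<in> {1..n}" for i
    using assms(4,5) that by (simp add: nonexp_mono_def sv_monotone_single)
  have w: "0 \<le> w i" if "i \<in> {1..n}" for i
    using assms(2)[OF that] by simp
  let ?Bi = "\<lambda>i. cayley (A i)"
  define B where "B = (\<lambda>x. \<Sum>i\<in>{1..n}. w i *\<^sub>R ?Bi i x)"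
  have Bi: "nonexp_mono (?Bi i)" if "i \<in> {1..n}" for i
    using cayley_nonexp_mono[OF A[OF that]] .
  have B: "nonexp_mono B"
    unfolding B_def by (rule nonexp_mono_convex_sum) (use Bi w assms(3) in auto)
  have avg: "resolvent_average {1..n} (\<lambda>i. single (A i)) w = single (reflected_resolvent B)"
    unfolding B_def by (rule resolvent_average_single) (use A w assms(3) in auto)
  have "\<forall>i\<in>{1..n}. maximally_monotone (single (?Bi i)) \<and> sv_nonexpansive (single (?Bi i))
      \<and> single (A i) = sv_diff (sv_scale 2 (resolvent (single (?Bi i)))) sv_Id"
  proof
    fix i assume i: "i \<in> {1..n}"
    show "maximally_monotone (single (?Bi i)) \<and> sv_nonexpansive (single (?Bi i))
      \<and> single (A i) = sv_diff (sv_scale 2 (resolvent (single (?Bi i)))) sv_Id"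
      using Bi[OF i] maximally_monotone_single[OF Bi[OF i]]
        sv_reflected_resolvent_single[OF Bi[OF i]] reflected_resolvent_cayley[OF A[OF i]]
      by (simp add: nonexp_mono_def)
  qed
  moreover have "single B = sv_sum (\<lambda>i. sv_scale (w i) (single (?Bi i))) {1..n}"
    by (simp add: sv_scale_single sv_sum_single B_def)
  moreover have "maximally_monotone (single B)" "sv_nonexpansive (single B)"
    using maximally_monotone_single[OF B] B by (simp_all add: nonexp_mono_def)
  moreover have "sv_nonexpansive (resolvent_average {1..n} (\<lambda>i. single (A i)) w)"
    using reflected_resolvent_nonexp_mono[OF B] unfolding avg by (simp add: nonexp_mono_def)
  moreover have "resolvent_average {1..n} (\<lambda>i. single (A i)) w
      = sv_diff (sv_scale 2 (resolvent (single B))) sv_Id"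
    unfolding avg sv_reflected_resolvent_single[OF B] ..
  ultimately show ?thesis
    by - (rule conjI, assumption, rule exI[of _ "\<lambda>i. single (?Bi i)"],
      rule exI[of _ "single B"], intro conjI)
qed

end
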